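(* Let $(\mathbb{R}^n,g)$, $n\ge 3$, be a pseudo-Euclidean space with coordinates $x=(x_1,\dots,x_n)$ and metric components $g_{ij}=\delta_{ij}\varepsilon_i$, $1\le i,j\le n$, where $\varepsilon_i=\pm1$. Let $\rho\in\mathbb{R}$, $\rho\neq0$. Consider smooth functions $\psi(r)$ and $h(r)$ with $r=\sum_{k=1}^n\varepsilon_kx_k^2$. Then there exists a metric $\bar g=\frac{1}{\psi^2}g$ such that $(\mathbb{R}^n,\bar g)$ is a gradient $\rho$-Einstein soliton with $h$ as a potential function (with constant $\lambda\in\mathbb{R}$) if and only if the functions $\psi$ and $h$ satisfy $$(n-2)\psi''+\psi h''+2\psi'h'=0$$ and $$2\psi\left[(n-2)\psi'+\psi h'\right]+2n[1-2(n-1)\rho]\psi\psi'+4r\left\{(n-1)\left[(\rho n-1)(\psi')^2-2\rho\psi\psi''\right]-\psi\psi'h'+\psi\psi''\right\}=\lambda,$$ where primes denote derivatives with respect to $r$.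
   Context: A semi-Riemannian manifold $(M^n,\bar g)$, $n\ge3$, is a gradient $\rho$-Einstein soliton ($\rho\in\mathbb{R}$, $\rho\ne0$) with potential function $h$ (a smooth function $h:M\to\mathbb{R}$) if $\mathrm{Ric}_{\bar g}+\mathrm{Hess}_{\bar g}h=\rho K_{\bar g}\,\bar g+\lambda\bar g$ for some constant $\lambda\in\mathbb{R}$, where $K_{\bar g}$ is the scalar curvature of $\bar g$. The notation $\psi(r)$, $h(r)$ means that the functions on $\mathbb{R}^n$ depend on $x$ only through $r$.
   Formalization: The function ψ is assumed to vanish nowhere on the range of r, as the metric g/ψ² requires; without this, ψ(r)=r with h constant and λ=0 satisfies both equations but gives no metric on all of R^n. *)

theory Defs
  imports "HOL-Analysis.Analysis"
begin

text \<open>Tensor fields on \<open>\<real>\<^sup>n\<close> (the manifold \<^typ>\<open>real^'n\<close> with its global chart)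
  are given by their components in the standard coordinates.\<close>

definition pd :: "'n::finite \<Rightarrow> (real^'n \<Rightarrow> real) \<Rightarrow> real^'n \<Rightarrow> real"
  where "pd i f x = frechet_derivative f (at x) (axis i 1)"

text \<open>\<open>C\<^sup>\<infinity>\<close>: every iterated partial derivative is differentiable (hence continuous) everywhere.\<close>

definition smooth :: "(real^'n::finite \<Rightarrow> real) \<Rightarrow> bool"
  where "smooth f \<longleftrightarrow> (\<forall>is. foldr pd is f differentiable_on UNIV)"

text \<open>No signature condition is needed: by continuity and nondegeneracy the index is constant
  on the connected space \<open>\<real>\<^sup>n\<close>.\<close>

definition semi_riemannian_metric :: "(real^'n::finite \<Rightarrow> real^'n^'n) \<Rightarrow> bool"
  where "semi_riemannian_metric g \<longleftrightarrow>
    (\<forall>i j. smooth (\<lambda>x. g x $ i $ j)) \<and>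
    (\<forall>x. transpose (g x) = g x) \<and>
    (\<forall>x. invertible (g x))"

text \<open>\<open>christoffel g k i j x\<close> is \<open>\<Gamma>\<close> with upper index \<open>k\<close> and lower indices \<open>i\<close>, \<open>j\<close>,
  of the Levi-Civita connection of \<open>g\<close>.\<close>

definition christoffel ::
    "(real^'n::finite \<Rightarrow> real^'n^'n) \<Rightarrow> 'n \<Rightarrow> 'n \<Rightarrow> 'n \<Rightarrow> real^'n \<Rightarrow> real"
  where "christoffel g k i j x =
    1/2 * (\<Sum>l\<in>UNIV. matrix_inv (g x) $ k $ l *
      (pd i (\<lambda>y. g y $ j $ l) x + pd j (\<lambda>y. g y $ i $ l) x - pd l (\<lambda>y. g y $ i $ j) x))"

text \<open>Sign convention: round spheres have positive Ricci curvature.\<close>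

definition ricci :: "(real^'n::finite \<Rightarrow> real^'n^'n) \<Rightarrow> 'n \<Rightarrow> 'n \<Rightarrow> real^'n \<Rightarrow> real"
  where "ricci g i j x =
    (\<Sum>k\<in>UNIV. pd k (christoffel g k i j) x - pd j (christoffel g k i k) x
      + (\<Sum>l\<in>UNIV. christoffel g k k l x * christoffel g l i j x
                 - christoffel g k j l x * christoffel g l i k x))"

definition scalar_curvature :: "(real^'n::finite \<Rightarrow> real^'n^'n) \<Rightarrow> real^'n \<Rightarrow> real"
  where "scalar_curvature g x =
    (\<Sum>i\<in>UNIV. \<Sum>j\<in>UNIV. matrix_inv (g x) $ i $ j * ricci g i j x)"

definition hessian ::
    "(real^'n::finite \<Rightarrow> real^'n^'n) \<Rightarrow> (real^'n \<Rightarrow> real) \<Rightarrow> 'n \<Rightarrow> 'n \<Rightarrow> real^'n \<Rightarrow> real"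
  where "hessian g h i j x = pd i (pd j h) x - (\<Sum>k\<in>UNIV. christoffel g k i j x * pd k h x)"

definition gradient_rho_Einstein_soliton ::
    "real \<Rightarrow> real \<Rightarrow> (real^'n::finite \<Rightarrow> real^'n^'n) \<Rightarrow> (real^'n \<Rightarrow> real) \<Rightarrow> bool"
  where "gradient_rho_Einstein_soliton \<rho> c g h \<longleftrightarrow>
    semi_riemannian_metric g \<and> smooth h \<and>
    (\<forall>x i j. ricci g i j x + hessian g h i j x
       = \<rho> * scalar_curvature g x * g x $ i $ j + c * g x $ i $ j)"

definition pseudo_euclidean :: "('n::finite \<Rightarrow> real) \<Rightarrow> real^'n \<Rightarrow> real^'n^'n"
  where "pseudo_euclidean \<epsilon> x = (\<chi> i j. if i = j then \<epsilon> i else 0)"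

definition rad :: "('n::finite \<Rightarrow> real) \<Rightarrow> real^'n \<Rightarrow> real"
  where "rad \<epsilon> x = (\<Sum>k\<in>UNIV. \<epsilon> k * (x $ k)\<^sup>2)"

text \<open>A function of \<open>r\<close> lives on the range of \<open>r\<close>, which is \<open>[0,\<infinity>)\<close>, \<open>(-\<infinity>,0]\<close> or \<open>\<real>\<close> according
  to whether the form is positive definite, negative definite or indefinite. Derivatives are taken
  within that interval, so they are one-sided at the endpoint \<open>0\<close> in the definite cases.\<close>

definition deriv_within :: "real set \<Rightarrow> (real \<Rightarrow> real) \<Rightarrow> real \<Rightarrow> real"
  where "deriv_within J f t = vector_derivative f (at t within J)"

definition smooth_on_interval :: "real set \<Rightarrow> (real \<Rightarrow> real) \<Rightarrow> bool"
  where "smooth_on_interval J f \<longleftrightarrow> (\<forall>k. (deriv_within J ^^ k) f differentiable_on J)"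

end

theory Submission
  imports Defs
begin

text \<open>Write \<open>X\<^sub>i = \<epsilon>\<^sub>i x\<^sub>i\<close> and \<open>a = 2\<psi>'/\<psi>\<close>. The Christoffel symbols of \<open>\<psi>\<^sup>-\<^sup>2 g\<close> are
  \<open>a(r)\<close> times expressions linear in \<open>x\<close>, so the difference of the two sides of the soliton equation
  has the form \<open>A(r) X\<^sub>i X\<^sub>j + B(r) \<epsilon>\<^sub>i \<delta>\<^sub>i\<^sub>j\<close>, where \<open>A\<close> and \<open>B\<close> are nonzero multiples of the defects of
  the two ordinary differential equations. If this tensor vanishes, its trace \<open>A r + n B\<close> and its
  contraction \<open>(A r + B) r\<close> with \<open>x\<close> twice vanish, which forces \<open>A = B = 0\<close> where \<open>r \<noteq> 0\<close>; the value
  \<open>r = 0\<close>, which may be attained only at the origin, is reached by continuity.\<close>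

section \<open>Rules for partial derivatives\<close>

lemma pd_eqI: "(f has_derivative f') (at x) \<Longrightarrow> pd i f x = f' (axis i 1)"
  unfolding pd_def by (metis frechet_derivative_at)

lemma pd_const: "pd i (\<lambda>x. c) = (\<lambda>x. 0)"
  by (rule ext, rule pd_eqI[THEN trans]) (rule has_derivative_const, simp)

lemma pd_coord: "pd i (\<lambda>x. x $ j) = (\<lambda>x. if j = i then 1 else 0)"
  by (rule ext, rule pd_eqI[THEN trans], rule bounded_linear_imp_has_derivative,
      rule bounded_linear_vec_nth) (simp add: axis_def)

lemma has_derivative_pd:
  "f differentiable (at x) \<Longrightarrow> (f has_derivative frechet_derivative f (at x)) (at x)"
  by (simp add: frechet_derivative_works)

lemma pd_add:
  assumes "f differentiable (at x)" "g differentiable (at x)"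
  shows "pd i (\<lambda>x. f x + g x) x = pd i f x + pd i g x"
  by (rule pd_eqI[THEN trans], rule has_derivative_add[OF has_derivative_pd has_derivative_pd])
     (auto simp: assms pd_def)

lemma pd_mult:
  assumes "f differentiable (at x)" "g differentiable (at x)"
  shows "pd i (\<lambda>x. f x * g x) x = f x * pd i g x + pd i f x * g x"
  by (rule pd_eqI[THEN trans], rule has_derivative_mult[OF has_derivative_pd has_derivative_pd])
     (auto simp: assms pd_def)

lemma pd_inverse:
  assumes "f differentiable (at x)" "f x \<noteq> 0"
  shows "pd i (\<lambda>x. inverse (f x)) x = - (inverse (f x) * pd i f x * inverse (f x))"
  by (rule pd_eqI[THEN trans], rule Deriv.has_derivative_inverse[OF _ has_derivative_pd])
     (auto simp: assms pd_def)

text \<open>Induction on the list of indices keeps every iterated partial derivative inside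
  \<open>C\<close>. Smoothness then follows from a suitable class of functions, without formulas for
  higher derivatives.\<close>

lemma smooth_if_pd_closed:
  assumes "f \<in> C"
    and "\<And>f x. f \<in> C \<Longrightarrow> f differentiable (at x)"
    and "\<And>f i. f \<in> C \<Longrightarrow> pd i f \<in> C"
  shows "smooth f"
proof -
  have "foldr pd is f \<in> C" for "is"
    by (induction "is") (auto simp: assms)
  then show ?thesis
    unfolding smooth_def differentiable_on_def by (auto intro: assms(2))
qed

section \<open>Chain rule for functions of r\<close>

lemma has_derivative_rad:
  "(rad \<epsilon> has_derivative (\<lambda>v. \<Sum>k\<in>UNIV. 2 * \<epsilon> k * x $ k * v $ k)) (at x)"
  unfolding rad_def [abs_def]
  by (auto intro!: derivative_eq_intros bounded_linear_imp_has_derivative simp: mult_ac)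

text \<open>Since \<open>rad \<epsilon>\<close> maps into its own range, a derivative of
  \<open>F\<close> within that range suffices for the chain rule. A one-sided derivative at the
  endpoint 0 thus still gives a full derivative in \<open>x\<close>.\<close>

lemma has_derivative_radial:
  assumes "(F has_real_derivative D) (at (rad \<epsilon> x) within range (rad \<epsilon>))"
  shows "((\<lambda>x. F (rad \<epsilon> x)) has_derivative (\<lambda>v. D * (\<Sum>k\<in>UNIV. 2 * \<epsilon> k * x $ k * v $ k))) (at x)"
  using has_derivative_in_compose[OF has_derivative_rad assms[unfolded has_field_derivative_def]]
  by simp

lemma sum_axis: "(\<Sum>k\<in>UNIV. c k * axis i (1::real) $ k) = c i"
  by (simp add: axis_def if_distrib cong: if_cong)

lemma pd_radial:
  assumes "(F has_real_derivative D) (at (rad \<epsilon> x) within range (rad \<epsilon>))"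
  shows "pd i (\<lambda>x. F (rad \<epsilon> x)) x = 2 * D * \<epsilon> i * x $ i"
  by (simp add: pd_eqI[OF has_derivative_radial[OF assms]] sum_axis)

text \<open>Both the Christoffel symbols and the first partial derivatives of the potential are
  radial functions times linear ones.\<close>

lemma pd_radial_mult_linear:
  assumes "(F has_real_derivative D) (at (rad \<epsilon> x) within range (rad \<epsilon>))" "bounded_linear L"
  shows "pd i (\<lambda>x. F (rad \<epsilon> x) * L x) x = 2 * D * \<epsilon> i * x $ i * L x + F (rad \<epsilon> x) * L (axis i 1)"
  by (simp add: pd_eqI[OF has_derivative_mult[OF has_derivative_radial[OF assms(1)]
        bounded_linear_imp_has_derivative[OF assms(2)]]] sum_axis)

section \<open>Smoothness on the range of r and on the whole space\<close>

lemma smooth_on_interval_derivative: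
  assumes "smooth_on_interval J F" "t \<in> J"
  shows "(F has_real_derivative deriv_within J F t) (at t within J)"
proof -
  have "F differentiable (at t within J)"
    using assms funpow_0[of "deriv_within J" F]
    unfolding smooth_on_interval_def differentiable_on_def by metis
  then show ?thesis
    unfolding deriv_within_def has_real_derivative_iff_has_vector_derivative
    by (simp add: vector_derivative_works)
qed

text \<open>The k-th iterate at the derivative is iterate k + 1 at \<open>F\<close>.\<close>

lemma smooth_on_interval_deriv_within:
  "smooth_on_interval J F \<Longrightarrow> smooth_on_interval J (deriv_within J F)"
  unfolding smooth_on_interval_def by (metis funpow_Suc_right comp_apply)

lemma smooth_on_interval_continuous:
  "smooth_on_interval J F \<Longrightarrow> continuous_on J F"
  using smooth_on_interval_derivative DERIV_continuous continuous_on_eq_continuous_within by blast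

text \<open>A class of functions closed under partial derivatives, hence consisting of smooth functions;
  it contains the components of the conformal metric and the potential.\<close>

inductive_set radial_functions :: "('n::finite \<Rightarrow> real) \<Rightarrow> (real^'n \<Rightarrow> real) set" for \<epsilon> where
  const: "(\<lambda>x. c) \<in> radial_functions \<epsilon>"
| coord: "(\<lambda>x. x $ i) \<in> radial_functions \<epsilon>"
| radial: "smooth_on_interval (range (rad \<epsilon>)) F \<Longrightarrow> (\<lambda>x. F (rad \<epsilon> x)) \<in> radial_functions \<epsilon>"
| add: "f \<in> radial_functions \<epsilon> \<Longrightarrow> g \<in> radial_functions \<epsilon> \<Longrightarrow> (\<lambda>x. f x + g x) \<in> radial_functions \<epsilon>"
| mult: "f \<in> radial_functions \<epsilon> \<Longrightarrow> g \<in> radial_functions \<epsilon> \<Longrightarrow> (\<lambda>x. f x * g x) \<in> radial_functions \<epsilon>"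
| inverse: "f \<in> radial_functions \<epsilon> \<Longrightarrow> (\<And>x. f x \<noteq> 0) \<Longrightarrow> (\<lambda>x. inverse (f x)) \<in> radial_functions \<epsilon>"

lemma radial_functions_differentiable:
  "f \<in> radial_functions \<epsilon> \<Longrightarrow> f differentiable (at x)"
proof (induction rule: radial_functions.induct)
  case (coord i)
  show ?case
    using bounded_linear_imp_has_derivative[OF bounded_linear_vec_nth] differentiable_def by blast
next
  case (radial F)
  show ?case
    using has_derivative_radial[OF smooth_on_interval_derivative[OF radial rangeI]]
      differentiable_def by blast
qed auto

lemma radial_functions_pd:
  "f \<in> radial_functions \<epsilon> \<Longrightarrow> pd i f \<in> radial_functions \<epsilon>"
proof (induction rule: radial_functions.induct)
  case (radial F)
  have "pd i (\<lambda>x. F (rad \<epsilon> x)) = (\<lambda>x. deriv_within (range (rad \<epsilon>)) F (rad \<epsilon> x) * (2 * \<epsilon> i * x $ i))"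
    by (rule ext) (simp add: pd_radial[OF smooth_on_interval_derivative[OF radial rangeI]])
  then show ?case
    by (auto intro!: radial_functions.intros smooth_on_interval_deriv_within radial)
next
  case (add f g)
  then have "pd i (\<lambda>x. f x + g x) = (\<lambda>x. pd i f x + pd i g x)"
    by (auto intro!: ext pd_add radial_functions_differentiable)
  with add show ?case by (auto intro: radial_functions.intros)
next
  case (mult f g)
  then have "pd i (\<lambda>x. f x * g x) = (\<lambda>x. f x * pd i g x + pd i f x * g x)"
    by (auto intro!: ext pd_mult radial_functions_differentiable)
  with mult show ?case by (auto intro: radial_functions.intros)
next
  case (inverse f)
  \<comment> \<open>Negation is not among the generators of the class, so the sign is written as the
    constant factor -1.\<close>
  then have "pd i (\<lambda>x. inverse (f x)) = (\<lambda>x. (-1) * (inverse (f x) * pd i f x * inverse (f x)))"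
    by (auto intro!: ext simp: pd_inverse radial_functions_differentiable)
  moreover have "\<dots> \<in> radial_functions \<epsilon>"
    by (rule radial_functions.mult[OF radial_functions.const radial_functions.mult[OF
          radial_functions.mult[OF radial_functions.inverse[OF inverse(1,2)] inverse(3)]
          radial_functions.inverse[OF inverse(1,2)]]])
  ultimately show ?case by simp
qed (auto simp: pd_const pd_coord intro: radial_functions.intros)

lemma radial_functions_smooth: "f \<in> radial_functions \<epsilon> \<Longrightarrow> smooth f"
  by (rule smooth_if_pd_closed[of _ "radial_functions \<epsilon>"])
     (simp_all add: radial_functions_differentiable radial_functions_pd)

section \<open>The conformal metric and algebra of its Christoffel symbols\<close>

definition conformal :: "('n::finite \<Rightarrow> real) \<Rightarrow> (real \<Rightarrow> real) \<Rightarrow> real^'n \<Rightarrow> real^'n^'n" where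
  "conformal \<epsilon> \<psi> x = (1 / (\<psi> (rad \<epsilon> x))\<^sup>2) *\<^sub>R pseudo_euclidean \<epsilon> x"

lemma conformal_nth: "conformal \<epsilon> \<psi> x $ i $ j = (if i = j then \<epsilon> i else 0) / (\<psi> (rad \<epsilon> x))\<^sup>2"
  by (simp add: conformal_def pseudo_euclidean_def)

text \<open>For signs, \<open>\<epsilon> i\<close> is its own reciprocal.\<close>

definition conformal_inv :: "('n::finite \<Rightarrow> real) \<Rightarrow> (real \<Rightarrow> real) \<Rightarrow> real^'n \<Rightarrow> real^'n^'n" where
  "conformal_inv \<epsilon> \<psi> x = (\<chi> i j. if i = j then \<epsilon> i * (\<psi> (rad \<epsilon> x))\<^sup>2 else 0)"

text \<open>These are the symbols of exp(2 \<phi>) g when the i-th partial derivative of \<phi> is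
  \<open>- a (rad \<epsilon> x) * \<epsilon> i * x $ i\<close>. The factor
  \<open>\<epsilon> k * \<epsilon> k = 1\<close> has been cancelled in the first term. Keeping
  \<open>a\<close> arbitrary separates the index algebra from \<psi>.\<close>

definition radial_christoffel ::
  "('n::finite \<Rightarrow> real) \<Rightarrow> (real \<Rightarrow> real) \<Rightarrow> 'n \<Rightarrow> 'n \<Rightarrow> 'n \<Rightarrow> real^'n \<Rightarrow> real" where
  "radial_christoffel \<epsilon> a k i j x = a (rad \<epsilon> x) *
     ((if i = j then \<epsilon> i * x $ k else 0) - (if j = k then \<epsilon> i * x $ i else 0)
      - (if i = k then \<epsilon> j * x $ j else 0))"

lemma pd_radial_christoffel:
  fixes x :: "real^'n::finite"
  assumes "(a has_real_derivative D) (at (rad \<epsilon> x) within range (rad \<epsilon>))"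
  shows "pd m (radial_christoffel \<epsilon> a k i j) x =
     2 * D * \<epsilon> m * x $ m * ((if i = j then \<epsilon> i * x $ k else 0) - (if j = k then \<epsilon> i * x $ i else 0)
      - (if i = k then \<epsilon> j * x $ j else 0))
    + a (rad \<epsilon> x) * ((if i = j \<and> k = m then \<epsilon> i else 0) - (if j = k \<and> i = m then \<epsilon> i else 0)
      - (if i = k \<and> j = m then \<epsilon> j else 0))"
proof -
  define L where "L y = (if i = j then \<epsilon> i * y $ k else 0) - (if j = k then \<epsilon> i * y $ i else 0)
      - (if i = k then \<epsilon> j * y $ j else 0)" for y :: "real^'n"
  \<comment> \<open>Each Kronecker delta selects between a multiple of a coordinate and the zero
    map, both linear.\<close>
  have c: "bounded_linear (\<lambda>y::real^'n. if P then c * y $ l else 0)" for P l and c :: real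
    by (cases P) (simp_all add: bounded_linear_const_mult bounded_linear_vec_nth bounded_linear_zero)
  have "bounded_linear L"
    unfolding L_def [abs_def] by (rule bounded_linear_sub[OF bounded_linear_sub[OF c c] c])
  then have "pd m (\<lambda>y. a (rad \<epsilon> y) * L y) x = 2 * D * \<epsilon> m * x $ m * L x + a (rad \<epsilon> x) * L (axis m 1)"
    by (rule pd_radial_mult_linear[OF assms])
  moreover have "L (axis m 1) = (if i = j \<and> k = m then \<epsilon> i else 0)
      - (if j = k \<and> i = m then \<epsilon> i else 0) - (if i = k \<and> j = m then \<epsilon> j else 0)"
    by (cases "i = j"; cases "j = k"; cases "i = k") (simp_all add: L_def axis_def)
  moreover have "radial_christoffel \<epsilon> a k i j = (\<lambda>y. a (rad \<epsilon> y) * L y)"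
    by (rule ext) (simp add: radial_christoffel_def L_def)
  ultimately show ?thesis
    by (simp only: L_def)
qed

lemma sum_rad: "(\<Sum>k\<in>UNIV. \<epsilon> k * x $ k * x $ k) = rad \<epsilon> x"
  by (simp add: rad_def power2_eq_square mult.assoc)

text \<open>On setting j = k the first and third terms cancel; the middle one is the same for every
  k.\<close>

lemma radial_christoffel_trace:
  "(\<Sum>k\<in>UNIV. radial_christoffel \<epsilon> a k i (k::'n::finite) x) =
     - real CARD('n) * a (rad \<epsilon> x) * (\<epsilon> i * x $ i)"
proof -
  have "radial_christoffel \<epsilon> a k i k x = - a (rad \<epsilon> x) * (\<epsilon> i * x $ i)" for k
    by (simp add: radial_christoffel_def)
  then show ?thesis by simp
qed

lemma radial_christoffel_sym: "radial_christoffel \<epsilon> a k i j = radial_christoffel \<epsilon> a k j i"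
  by (rule ext) (simp add: radial_christoffel_def)

text \<open>Needed twice: the trace of the Christoffel symbols and the differential of the potential
  are both radial multiples of \<open>\<epsilon> l * x $ l\<close>.\<close>

lemma radial_christoffel_contract:
  "(\<Sum>l\<in>UNIV. \<epsilon> l * x $ l * radial_christoffel \<epsilon> a l i j x) =
     a (rad \<epsilon> x) * ((if i = j then \<epsilon> i * rad \<epsilon> x else 0) - 2 * (\<epsilon> i * x $ i) * (\<epsilon> j * x $ j))"
proof -
  have "\<epsilon> l * x $ l * radial_christoffel \<epsilon> a l i j x =
      (if i = j then a (rad \<epsilon> x) * \<epsilon> i * (\<epsilon> l * x $ l * x $ l) else 0)
      - (if j = l then a (rad \<epsilon> x) * (\<epsilon> l * x $ l) * (\<epsilon> i * x $ i) else 0)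
      - (if i = l then a (rad \<epsilon> x) * (\<epsilon> l * x $ l) * (\<epsilon> j * x $ j) else 0)" for l
    by (auto simp: radial_christoffel_def algebra_simps)
  then have "(\<Sum>l\<in>UNIV. \<epsilon> l * x $ l * radial_christoffel \<epsilon> a l i j x) =
      (if i = j then a (rad \<epsilon> x) * \<epsilon> i * rad \<epsilon> x else 0)
      - a (rad \<epsilon> x) * (\<epsilon> j * x $ j) * (\<epsilon> i * x $ i)
      - a (rad \<epsilon> x) * (\<epsilon> i * x $ i) * (\<epsilon> j * x $ j)"
    by (simp add: sum_subtractf flip: sum_rad sum_distrib_left)
  then show ?thesis by (auto simp: algebra_simps)
qed

text \<open>Expanding only the first factor lets its deltas collapse the double sum to three single
  sums: a contraction with the position vector, a trace and a contraction with
  \<open>\<epsilon> l * x $ l\<close>.\<close>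

lemma radial_christoffel_square:
  fixes x :: "real^'n::finite"
  shows "(\<Sum>k\<in>UNIV. \<Sum>l\<in>UNIV. radial_christoffel \<epsilon> a k j l x * radial_christoffel \<epsilon> a l i k x) =
    (a (rad \<epsilon> x))\<^sup>2 * ((real CARD('n) + 2) * (\<epsilon> i * x $ i) * (\<epsilon> j * x $ j)
      - (if i = j then 2 * \<epsilon> i * rad \<epsilon> x else 0))"
proof -
  let ?G = "\<lambda>k i j. radial_christoffel \<epsilon> a k i j x"
  let ?a = "a (rad \<epsilon> x)" and ?X = "\<lambda>i. \<epsilon> i * x $ i"
  have inner: "(\<Sum>l\<in>UNIV. ?G k j l * ?G l i k) =
      ?a * \<epsilon> j * (x $ k * ?G j i k) - ?a * ?X j * ?G k i k
        - (if j = k then ?a * (\<Sum>l\<in>UNIV. ?X l * ?G l i k) else 0)" for k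
  proof -
    have "?G k j l * ?G l i k =
       (if j = l then ?a * \<epsilon> j * (x $ k * ?G l i k) else 0)
       - (if l = k then ?a * ?X j * ?G l i k else 0)
       - (if j = k then ?a * (?X l * ?G l i k) else 0)" for l
      by (auto simp: radial_christoffel_def[of \<epsilon> a k j l] algebra_simps)
    then show ?thesis
      by (simp add: sum_subtractf flip: sum_distrib_left)
  qed
  \<comment> \<open>Contracting a lower index with the position vector makes the two terms in
    \<open>x $ i * x $ j\<close> cancel.\<close>
  have outer: "(\<Sum>k\<in>UNIV. x $ k * ?G j i k) = - ?a * (if i = j then rad \<epsilon> x else 0)"
  proof -
    have "x $ k * ?G j i k =
       (if k = i then ?a * \<epsilon> i * x $ k * x $ j else 0)
       - (if k = j then ?a * x $ k * ?X i else 0)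
       - (if i = j then ?a * (\<epsilon> k * x $ k * x $ k) else 0)" for k
      by (auto simp: radial_christoffel_def algebra_simps)
    then show ?thesis
      by (simp add: sum_subtractf flip: sum_rad sum_distrib_left)
  qed
  have "(\<Sum>k\<in>UNIV. \<Sum>l\<in>UNIV. ?G k j l * ?G l i k) =
     ?a * \<epsilon> j * (\<Sum>k\<in>UNIV. x $ k * ?G j i k) - ?a * ?X j * (\<Sum>k\<in>UNIV. ?G k i k)
       - ?a * (\<Sum>l\<in>UNIV. ?X l * ?G l i j)"
    unfolding inner by (simp add: sum_subtractf flip: sum_distrib_left)
  also have "\<dots> = (?a)\<^sup>2 * ((real CARD('n) + 2) * ?X i * ?X j - (if i = j then 2 * \<epsilon> i * rad \<epsilon> x else 0))"
    unfolding outer radial_christoffel_trace radial_christoffel_contract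
    by (auto simp: algebra_simps power2_eq_square)
  finally show ?thesis .
qed

text \<open>A right inverse of a square matrix is two-sided, so the choice in
  \<open>matrix_inv\<close> has a witness, and uniqueness of inverses identifies it with
  \<open>B\<close>.\<close>

lemma matrix_inv_eqI:
  fixes A :: "real^'n::finite^'n"
  assumes "A ** B = mat 1"
  shows "matrix_inv A = B"
proof -
  have "B ** A = mat 1"
    using assms matrix_left_right_inverse by blast
  with assms have "\<exists>B. A ** B = mat 1 \<and> B ** A = mat 1" by blast
  from someI_ex[OF this] have "matrix_inv A ** A = mat 1"
    unfolding matrix_inv_def by simp
  then show ?thesis
    by (metis assms matrix_mul_assoc matrix_mul_lid matrix_mul_rid)
qed

section \<open>Levi-Civita connection of the conformal metric\<close>

locale radial_conformal =
  fixes \<epsilon> :: "'n::finite \<Rightarrow> real" and \<psi> h :: "real \<Rightarrow> real"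
  assumes eps: "\<epsilon> i = 1 \<or> \<epsilon> i = -1"
    and psi_smooth: "smooth_on_interval (range (rad \<epsilon>)) \<psi>"
    and psi_nonzero: "r \<in> range (rad \<epsilon>) \<Longrightarrow> \<psi> r \<noteq> 0"
    and h_smooth: "smooth_on_interval (range (rad \<epsilon>)) h"
begin

abbreviation "J \<equiv> range (rad \<epsilon>)"
abbreviation "\<psi>' \<equiv> deriv_within J \<psi>"
abbreviation "\<psi>'' \<equiv> deriv_within J \<psi>'"
abbreviation "h' \<equiv> deriv_within J h"
abbreviation "h'' \<equiv> deriv_within J h'"
abbreviation "X x i \<equiv> \<epsilon> i * x $ i"

text \<open>The logarithmic derivative of \<open>\<psi>\<^sup>2\<close>; \<open>a'\<close> is its
  derivative by the quotient rule.\<close>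

definition "a t = 2 * \<psi>' t / \<psi> t"
definition "a' t = 2 * (\<psi>'' t * \<psi> t - (\<psi>' t)\<^sup>2) / (\<psi> t)\<^sup>2"

lemma eps_sq: "\<epsilon> i * \<epsilon> i = 1"
  using eps[of i] by auto

lemma psi_rad_nonzero: "\<psi> (rad \<epsilon> x) \<noteq> 0"
  by (simp add: psi_nonzero)

lemmas psi_deriv = smooth_on_interval_derivative[OF psi_smooth]
lemmas psi'_deriv = smooth_on_interval_derivative[OF smooth_on_interval_deriv_within[OF psi_smooth]]
lemmas h_deriv = smooth_on_interval_derivative[OF h_smooth]
lemmas h'_deriv = smooth_on_interval_derivative[OF smooth_on_interval_deriv_within[OF h_smooth]]

lemma a_deriv:
  assumes "t \<in> J"
  shows "(a has_real_derivative a' t) (at t within J)"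
  unfolding a_def [abs_def] a'_def using psi_nonzero[OF assms]
  by (auto intro!: derivative_eq_intros psi_deriv psi'_deriv assms simp: field_simps power2_eq_square)

lemma conformal_mult_inv: "conformal \<epsilon> \<psi> x ** conformal_inv \<epsilon> \<psi> x = mat 1"
proof -
  have "(\<Sum>k\<in>UNIV. conformal \<epsilon> \<psi> x $ i $ k * conformal_inv \<epsilon> \<psi> x $ k $ j) = (if i = j then 1 else 0)"
    for i j
  proof -
    have "conformal \<epsilon> \<psi> x $ i $ k * conformal_inv \<epsilon> \<psi> x $ k $ j
        = (if k = i then if i = j then 1 else 0 else 0)" for k
      using psi_rad_nonzero[of x] by (simp add: conformal_nth conformal_inv_def eps_sq)
    then show ?thesis by simp
  qed
  then show ?thesis
    by (simp add: matrix_matrix_mult_def mat_def vec_eq_iff)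
qed

lemma matrix_inv_conformal: "matrix_inv (conformal \<epsilon> \<psi> x) = conformal_inv \<epsilon> \<psi> x"
  by (rule matrix_inv_eqI[OF conformal_mult_inv])

lemma semi_riemannian_conformal: "semi_riemannian_metric (conformal \<epsilon> \<psi>)"
  unfolding semi_riemannian_metric_def
proof (intro conjI allI)
  fix i j
  have psi: "(\<lambda>x. \<psi> (rad \<epsilon> x)) \<in> radial_functions \<epsilon>"
    by (rule radial_functions.radial[OF psi_smooth])
  have inv: "(\<lambda>x. inverse (\<psi> (rad \<epsilon> x))) \<in> radial_functions \<epsilon>"
    by (rule radial_functions.inverse[OF psi psi_rad_nonzero])
  \<comment> \<open>The component is built from constants, products and inverses, the operations
    under which the class is closed.\<close>
  have "(\<lambda>x. (if i = j then \<epsilon> i else 0) * (inverse (\<psi> (rad \<epsilon> x)) * inverse (\<psi> (rad \<epsilon> x))))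
      \<in> radial_functions \<epsilon>"
    by (rule radial_functions.mult[OF radial_functions.const radial_functions.mult[OF inv inv]])
  moreover have "(\<lambda>x. conformal \<epsilon> \<psi> x $ i $ j)
      = (\<lambda>x. (if i = j then \<epsilon> i else 0) * (inverse (\<psi> (rad \<epsilon> x)) * inverse (\<psi> (rad \<epsilon> x))))"
    by (simp add: conformal_nth fun_eq_iff divide_inverse power2_eq_square)
  ultimately show "smooth (\<lambda>x. conformal \<epsilon> \<psi> x $ i $ j)"
    using radial_functions_smooth by metis
next
  fix x
  show "transpose (conformal \<epsilon> \<psi> x) = conformal \<epsilon> \<psi> x"
    by (simp add: transpose_def conformal_nth vec_eq_iff)
  show "invertible (conformal \<epsilon> \<psi> x)"
    using conformal_mult_inv invertible_right_inverse by blast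
qed

lemma smooth_h_rad: "smooth (\<lambda>x. h (rad \<epsilon> x))"
  by (rule radial_functions_smooth[OF radial_functions.radial[OF h_smooth]])

text \<open>By the choice of \<open>a\<close>, the reciprocal of \<open>\<psi>\<^sup>2\<close> has
  derivative - \<open>a\<close> times itself; the chain rule for r supplies
  \<open>2 * X x m\<close>.\<close>

lemma pd_conformal:
  "pd m (\<lambda>y. conformal \<epsilon> \<psi> y $ i $ j) x =
     (if i = j then \<epsilon> i else 0) * (- 2 * a (rad \<epsilon> x) / (\<psi> (rad \<epsilon> x))\<^sup>2) * X x m"
proof -
  let ?r = "rad \<epsilon> x" and ?c = "if i = j then \<epsilon> i else 0"
  have "((\<lambda>t. ?c / (\<psi> t)\<^sup>2) has_real_derivative ?c * (- a ?r / (\<psi> ?r)\<^sup>2)) (at ?r within J)"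
    unfolding a_def using psi_rad_nonzero[of x]
    by (auto intro!: derivative_eq_intros psi_deriv simp: field_simps power2_eq_square eval_nat_numeral)
  from pd_radial[OF this, of m] show ?thesis
    by (simp add: conformal_nth mult.assoc)
qed

lemma christoffel_conformal:
  "christoffel (conformal \<epsilon> \<psi>) k i j = radial_christoffel \<epsilon> a k i j"
proof
  fix x
  let ?p = "\<lambda>m i j. pd m (\<lambda>y. conformal \<epsilon> \<psi> y $ i $ j) x"
  have "matrix_inv (conformal \<epsilon> \<psi> x) $ k $ l * (?p i j l + ?p j i l - ?p l i j) =
      (if k = l then \<epsilon> k * (\<psi> (rad \<epsilon> x))\<^sup>2 * (?p i j k + ?p j i k - ?p k i j) else 0)" for l
    by (simp add: matrix_inv_conformal conformal_inv_def)
  then have "christoffel (conformal \<epsilon> \<psi>) k i j x =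
      1/2 * (\<epsilon> k * (\<psi> (rad \<epsilon> x))\<^sup>2 * (?p i j k + ?p j i k - ?p k i j))"
    by (simp add: christoffel_def)
  also have "\<dots> = \<epsilon> k * a (rad \<epsilon> x) * ((if i = j then \<epsilon> i * X x k else 0)
      - (if j = k then \<epsilon> j * X x i else 0) - (if i = k then \<epsilon> i * X x j else 0))"
    unfolding pd_conformal using psi_rad_nonzero[of x] by (simp add: field_simps)
  \<comment> \<open>Under each delta the signs are regrouped into a visible
    \<open>\<epsilon> k * \<epsilon> k\<close>, which \<open>eps_sq\<close> then removes.\<close>
  also have "\<dots> = a (rad \<epsilon> x) * ((if i = j then \<epsilon> i * ((\<epsilon> k * \<epsilon> k) * x $ k) else 0)
      - (if j = k then (\<epsilon> k * \<epsilon> k) * X x i else 0) - (if i = k then (\<epsilon> k * \<epsilon> k) * X x j else 0))"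
    by (cases "i = j"; cases "j = k"; cases "i = k") (simp_all add: algebra_simps)
  also have "\<dots> = radial_christoffel \<epsilon> a k i j x"
    by (simp add: eps_sq radial_christoffel_def)
  finally show "christoffel (conformal \<epsilon> \<psi>) k i j x = radial_christoffel \<epsilon> a k i j x" .
qed

section \<open>Ricci tensor, scalar curvature and Hessian\<close>

text \<open>The coordinate formula splits into four sums. With n the dimension, their coefficients
  of \<open>X x i * X x j\<close> are -4 a', 2n a', 2n a^2 and -(n + 2) a^2, the subtractions
  included.\<close>

lemma ricci_conformal:
  fixes x :: "real^'n"
  defines "r \<equiv> rad \<epsilon> x"
  shows "ricci (conformal \<epsilon> \<psi>) i j x =
    (real CARD('n) - 2) * (2 * a' r + (a r)\<^sup>2) * X x i * X x j
    + (if i = j then \<epsilon> i * (2 * r * a' r + 2 * (real CARD('n) - 1) * a r - (real CARD('n) - 2) * r * (a r)\<^sup>2) else 0)"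
proof -
  let ?G = "\<lambda>k i j. radial_christoffel \<epsilon> a k i j x"
  have a: "(a has_real_derivative a' r) (at (rad \<epsilon> x) within J)"
    unfolding r_def by (rule a_deriv) simp
  have divergence: "(\<Sum>k\<in>UNIV. pd k (radial_christoffel \<epsilon> a k i j) x) =
      2 * a' r * ((if i = j then \<epsilon> i * r else 0) - 2 * X x i * X x j)
      + (if i = j then (real CARD('n) - 2) * a r * \<epsilon> i else 0)"
  proof -
    \<comment> \<open>Every summand either carries the r-density
      \<open>\<epsilon> k * x $ k * x $ k\<close>, or is constant in k, or is selected by one delta,
      so the sum over k can be read off.\<close>
    have "pd k (radial_christoffel \<epsilon> a k i j) x =
       (if i = j then 2 * a' r * \<epsilon> i * (\<epsilon> k * x $ k * x $ k) else 0)
       - (if k = j then 2 * a' r * X x k * X x i else 0)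
       - (if k = i then 2 * a' r * X x k * X x j else 0)
       + (if i = j then a r * \<epsilon> i else 0)
       - (if k = j then if i = j then a r * \<epsilon> i else 0 else 0)
       - (if k = i then if i = j then a r * \<epsilon> i else 0 else 0)" for k
      unfolding pd_radial_christoffel[OF a]
      by (cases "i = j"; cases "j = k"; cases "i = k") (simp_all add: algebra_simps r_def)
    then have "(\<Sum>k\<in>UNIV. pd k (radial_christoffel \<epsilon> a k i j) x) =
       (if i = j then 2 * a' r * \<epsilon> i * r else 0) - 2 * a' r * X x j * X x i - 2 * a' r * X x i * X x j
       + (if i = j then real CARD('n) * (a r * \<epsilon> i) else 0)
       - (if i = j then a r * \<epsilon> i else 0) - (if i = j then a r * \<epsilon> i else 0)"
      unfolding r_def by (simp add: sum_subtractf sum.distrib flip: sum_rad sum_distrib_left)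
    then show ?thesis
      by (cases "i = j") (simp_all add: algebra_simps)
  qed
  have trace: "pd j (radial_christoffel \<epsilon> a k i k) x =
      - 2 * a' r * X x i * X x j - (if i = j then a r * \<epsilon> i else 0)" for k
    unfolding pd_radial_christoffel[OF a]
    by (cases "i = j"; cases "j = k"; cases "i = k") (simp_all add: algebra_simps r_def)
  have product: "(\<Sum>k\<in>UNIV. \<Sum>l\<in>UNIV. ?G k k l * ?G l i j) =
      - real CARD('n) * (a r)\<^sup>2 * ((if i = j then \<epsilon> i * r else 0) - 2 * X x i * X x j)"
  proof -
    \<comment> \<open>Symmetry in the lower indices turns the first factor into the trace computed
      above.\<close>
    have "(\<Sum>k\<in>UNIV. \<Sum>l\<in>UNIV. ?G k k l * ?G l i j) = (\<Sum>l\<in>UNIV. (\<Sum>k\<in>UNIV. ?G k l k) * ?G l i j)"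
      by (subst sum.swap) (simp add: sum_distrib_right radial_christoffel_sym)
    also have "\<dots> = - real CARD('n) * a r * (\<Sum>l\<in>UNIV. X x l * ?G l i j)"
      unfolding radial_christoffel_trace by (simp add: sum_distrib_left mult.assoc r_def)
    finally show ?thesis
      unfolding radial_christoffel_contract by (simp add: power2_eq_square r_def)
  qed
  have "ricci (conformal \<epsilon> \<psi>) i j x =
      (\<Sum>k\<in>UNIV. pd k (radial_christoffel \<epsilon> a k i j) x) - (\<Sum>k\<in>UNIV. pd j (radial_christoffel \<epsilon> a k i k) x)
      + ((\<Sum>k\<in>UNIV. \<Sum>l\<in>UNIV. ?G k k l * ?G l i j) - (\<Sum>k\<in>UNIV. \<Sum>l\<in>UNIV. ?G k j l * ?G l i k))"
    by (simp add: ricci_def christoffel_conformal sum_subtractf sum.distrib)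
  also have "\<dots> = (real CARD('n) - 2) * (2 * a' r + (a r)\<^sup>2) * X x i * X x j
    + (if i = j then \<epsilon> i * (2 * r * a' r + 2 * (real CARD('n) - 1) * a r - (real CARD('n) - 2) * r * (a r)\<^sup>2) else 0)"
    unfolding divergence trace product radial_christoffel_square r_def[symmetric]
    by (cases "i = j") (simp_all add: algebra_simps)
  finally show ?thesis .
qed

text \<open>Tracing P X_i X_j + Q \<epsilon>_i \<delta>_ij with the diagonal inverse metric gives
  \<psi>^2 (P r + n Q), because the squared signs are 1.\<close>

lemma scalar_curvature_conformal:
  fixes x :: "real^'n"
  defines "r \<equiv> rad \<epsilon> x"
  shows "scalar_curvature (conformal \<epsilon> \<psi>) x = (\<psi> r)\<^sup>2 *
    ((real CARD('n) - 2) * (2 * a' r + (a r)\<^sup>2) * r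
     + real CARD('n) * (2 * r * a' r + 2 * (real CARD('n) - 1) * a r - (real CARD('n) - 2) * r * (a r)\<^sup>2))"
proof -
  let ?P = "(real CARD('n) - 2) * (2 * a' r + (a r)\<^sup>2)"
  let ?Q = "2 * r * a' r + 2 * (real CARD('n) - 1) * a r - (real CARD('n) - 2) * r * (a r)\<^sup>2"
  have "(\<Sum>j\<in>UNIV. matrix_inv (conformal \<epsilon> \<psi> x) $ i $ j * ricci (conformal \<epsilon> \<psi>) i j x)
      = (\<psi> r)\<^sup>2 * ?P * (\<epsilon> i * x $ i * x $ i) + (\<psi> r)\<^sup>2 * ?Q" for i
  proof -
    have "matrix_inv (conformal \<epsilon> \<psi> x) $ i $ j * ricci (conformal \<epsilon> \<psi>) i j x
        = (if i = j then \<epsilon> i * (\<psi> r)\<^sup>2 * (?P * X x i * X x i + \<epsilon> i * ?Q) else 0)" for j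
      by (simp add: matrix_inv_conformal conformal_inv_def ricci_conformal r_def)
    then have "(\<Sum>j\<in>UNIV. matrix_inv (conformal \<epsilon> \<psi> x) $ i $ j * ricci (conformal \<epsilon> \<psi>) i j x)
        = \<epsilon> i * (\<psi> r)\<^sup>2 * (?P * X x i * X x i + \<epsilon> i * ?Q)"
      by simp
    also have "\<dots> = (\<psi> r)\<^sup>2 * ?P * ((\<epsilon> i * \<epsilon> i) * (\<epsilon> i * x $ i * x $ i)) + (\<epsilon> i * \<epsilon> i) * ((\<psi> r)\<^sup>2 * ?Q)"
      by (simp only: distrib_left mult_ac)
    finally show ?thesis by (simp add: eps_sq)
  qed
  then have "scalar_curvature (conformal \<epsilon> \<psi>) x = (\<psi> r)\<^sup>2 * ?P * r + real CARD('n) * ((\<psi> r)\<^sup>2 * ?Q)"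
    by (simp add: scalar_curvature_def sum.distrib sum_rad r_def flip: sum_distrib_left)
  then show ?thesis by (simp only: distrib_left mult_ac)
qed

text \<open>The differential of the potential is \<open>2 * h' r\<close> times \<open>X x\<close>,
  so the connection term reduces to \<open>radial_christoffel_contract\<close>.\<close>

lemma hessian_conformal:
  fixes x :: "real^'n"
  defines "r \<equiv> rad \<epsilon> x"
  shows "hessian (conformal \<epsilon> \<psi>) (\<lambda>x. h (rad \<epsilon> x)) i j x =
    (4 * h'' r + 4 * a r * h' r) * X x i * X x j
    + (if i = j then \<epsilon> i * (2 * h' r - 2 * r * a r * h' r) else 0)"
proof -
  have pd_h: "pd k (\<lambda>x. h (rad \<epsilon> x)) = (\<lambda>x. h' (rad \<epsilon> x) * (2 * \<epsilon> k * x $ k))" for k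
    by (rule ext) (simp add: pd_radial[OF h_deriv[OF rangeI]])
  have "bounded_linear (\<lambda>x::real^'n. 2 * \<epsilon> j * x $ j)"
    by (rule bounded_linear_const_mult[OF bounded_linear_vec_nth])
  from pd_radial_mult_linear[OF h'_deriv[OF rangeI] this]
  have "pd i (pd j (\<lambda>x. h (rad \<epsilon> x))) x =
      4 * h'' r * X x i * X x j + (if i = j then 2 * h' r * \<epsilon> i else 0)"
    unfolding pd_h by (simp add: axis_def r_def)
  moreover have "(\<Sum>k\<in>UNIV. christoffel (conformal \<epsilon> \<psi>) k i j x * pd k (\<lambda>x. h (rad \<epsilon> x)) x) =
      2 * h' r * (\<Sum>k\<in>UNIV. X x k * radial_christoffel \<epsilon> a k i j x)"
    unfolding pd_h christoffel_conformal by (simp add: sum_distrib_left mult_ac r_def)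
  ultimately show ?thesis
    unfolding hessian_def radial_christoffel_contract r_def[symmetric]
    by (cases "i = j") (simp_all add: algebra_simps)
qed

section \<open>The soliton equation as a tensor identity\<close>

text \<open>Left-hand sides of the two differential equations.\<close>

definition "E1 r = (real CARD('n) - 2) * \<psi>'' r + \<psi> r * h'' r + 2 * \<psi>' r * h' r"

definition "E2 \<rho> r = 2 * \<psi> r * ((real CARD('n) - 2) * \<psi>' r + \<psi> r * h' r)
  + 2 * real CARD('n) * (1 - 2 * (real CARD('n) - 1) * \<rho>) * \<psi> r * \<psi>' r
  + 4 * r * ((real CARD('n) - 1) * ((\<rho> * real CARD('n) - 1) * (\<psi>' r)\<^sup>2 - 2 * \<rho> * \<psi> r * \<psi>'' r)
             - \<psi> r * \<psi>' r * h' r + \<psi> r * \<psi>'' r)"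

text \<open>The metric terms are diagonal, so \<rho> and \<Lambda> enter only the second
  coefficient.\<close>

lemma soliton_defect:
  fixes x :: "real^'n"
  defines "r \<equiv> rad \<epsilon> x"
  shows "ricci (conformal \<epsilon> \<psi>) i j x + hessian (conformal \<epsilon> \<psi>) (\<lambda>x. h (rad \<epsilon> x)) i j x
      - (\<rho> * scalar_curvature (conformal \<epsilon> \<psi>) x * conformal \<epsilon> \<psi> x $ i $ j + \<Lambda> * conformal \<epsilon> \<psi> x $ i $ j)
    = 4 * E1 r / \<psi> r * X x i * X x j + (if i = j then \<epsilon> i * ((E2 \<rho> r - \<Lambda>) / (\<psi> r)\<^sup>2) else 0)"
proof -
  define P where "P = (real CARD('n) - 2) * (2 * a' r + (a r)\<^sup>2)"
  define Q where "Q = 2 * r * a' r + 2 * (real CARD('n) - 1) * a r - (real CARD('n) - 2) * r * (a r)\<^sup>2"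
  have nz: "\<psi> r \<noteq> 0"
    by (simp add: r_def psi_rad_nonzero)
  \<comment> \<open>In \<open>P\<close> the squares of \<open>\<psi>'\<close> coming from
    \<open>a'\<close> and from the square of \<open>a\<close> cancel, leaving 4 (n - 2) \<psi>'' /
    \<psi>.\<close>
  have A: "P + (4 * h'' r + 4 * a r * h' r) = 4 * E1 r / \<psi> r"
    unfolding P_def E1_def a_def a'_def using nz by (simp add: field_simps power2_eq_square)
  have B: "(Q + (2 * h' r - 2 * r * a r * h' r)) - (\<rho> * ((\<psi> r)\<^sup>2 * (P * r + real CARD('n) * Q)) + \<Lambda>) / (\<psi> r)\<^sup>2
      = (E2 \<rho> r - \<Lambda>) / (\<psi> r)\<^sup>2"
    unfolding P_def Q_def E2_def a_def a'_def using nz by (simp add: field_simps power2_eq_square)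
  show ?thesis
    unfolding ricci_conformal hessian_conformal scalar_curvature_conformal conformal_nth
      r_def[symmetric] P_def[symmetric] Q_def[symmetric] A[symmetric] B[symmetric]
    using nz by (cases "i = j") (simp_all add: field_simps)
qed

text \<open>Smoothness and nondegeneracy hold already, so only the vanishing of the defect
  remains.\<close>

lemma soliton_iff_defect:
  "gradient_rho_Einstein_soliton \<rho> \<Lambda> (conformal \<epsilon> \<psi>) (\<lambda>x. h (rad \<epsilon> x)) \<longleftrightarrow>
   (\<forall>x i j. 4 * E1 (rad \<epsilon> x) / \<psi> (rad \<epsilon> x) * X x i * X x j
      + (if i = j then \<epsilon> i * ((E2 \<rho> (rad \<epsilon> x) - \<Lambda>) / (\<psi> (rad \<epsilon> x))\<^sup>2) else 0) = 0)"
  unfolding gradient_rho_Einstein_soliton_def soliton_defect[symmetric]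
  by (simp add: semi_riemannian_conformal smooth_h_rad)

section \<open>Separating the two coefficients\<close>

text \<open>The trace gives A r + n B = 0 and double contraction with x gives (A r + B) r = 0.
  Dividing by r and subtracting leaves (n - 1) B = 0, hence B = 0 and then A = 0.\<close>

lemma radial_tensor_eq_0:
  fixes x :: "real^'n"
  assumes "CARD('n) \<ge> 2" and "rad \<epsilon> x \<noteq> 0"
    and zero: "\<And>i j. A * X x i * X x j + (if i = j then \<epsilon> i * B else 0) = 0"
  shows "A = 0 \<and> B = 0"
proof -
  let ?r = "rad \<epsilon> x"
  \<comment> \<open>The weights \<open>\<epsilon> i\<close> make this the trace with respect to the
    flat metric.\<close>
  have "0 = (\<Sum>i\<in>UNIV. \<epsilon> i * (A * X x i * X x i + \<epsilon> i * B))"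
    using zero[of i i for i] by simp
  also have "\<dots> = (\<Sum>i\<in>UNIV. A * ((\<epsilon> i * \<epsilon> i) * (\<epsilon> i * x $ i * x $ i)) + (\<epsilon> i * \<epsilon> i) * B)"
    by (rule sum.cong[OF refl]) (simp only: distrib_left mult_ac)
  also have "\<dots> = A * ?r + real CARD('n) * B"
    by (simp add: eps_sq sum.distrib sum_rad flip: sum_distrib_left)
  finally have trace: "A * ?r + real CARD('n) * B = 0" by simp
  have "(A * ?r + B) * X x i = 0" for i
  proof -
    have "0 = (\<Sum>j\<in>UNIV. x $ j * (A * X x i * X x j + (if i = j then \<epsilon> i * B else 0)))"
      by (simp add: zero)
    also have "\<dots> = (\<Sum>j\<in>UNIV. A * X x i * (\<epsilon> j * x $ j * x $ j) + (if i = j then x $ i * \<epsilon> i * B else 0))"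
      by (rule sum.cong[OF refl]) (simp add: algebra_simps)
    also have "\<dots> = A * X x i * ?r + x $ i * \<epsilon> i * B"
      by (simp add: sum.distrib sum_rad flip: sum_distrib_left)
    finally show ?thesis by (simp add: algebra_simps)
  qed
  \<comment> \<open>Second contraction with x: the remaining free index is summed to produce another
    factor r.\<close>
  then have "(\<Sum>i\<in>UNIV. (A * ?r + B) * X x i * x $ i) = 0"
    by (intro sum.neutral ballI) (simp only: mult_zero_left)
  then have "(A * ?r + B) * ?r = 0"
    by (simp add: mult.assoc flip: sum_distrib_left sum_rad)
  then have "A * ?r + B = 0"
    using assms(2) by simp
  moreover have "(real CARD('n) - 1) * B = (A * ?r + real CARD('n) * B) - (A * ?r + B)"
    by (simp only: left_diff_distrib mult_1_left add_diff_add diff_self add_0_left)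
  ultimately have "(real CARD('n) - 1) * B = 0"
    using trace by (simp only: diff_self)
  with assms(1) have "B = 0" by simp
  with trace assms(2) show ?thesis by simp
qed

section \<open>The value r = 0\<close>

lemma rad_axis: "rad \<epsilon> (axis i c) = \<epsilon> i * c\<^sup>2"
proof -
  have "\<epsilon> k * (axis i c $ k)\<^sup>2 = (if k = i then \<epsilon> i * c\<^sup>2 else 0)" for k
    by (simp add: axis_def)
  then show ?thesis by (simp add: rad_def)
qed

text \<open>The range is a connected image containing both 0 and a sign, and a connected set that is
  not a singleton has no isolated points. The index \<open>undefined\<close> merely names some
  coordinate axis.\<close>

lemma zero_islimpt_J: "0 islimpt J"
proof (rule connected_imp_perfect)
  have "continuous_on UNIV (rad \<epsilon>)"
    by (intro continuous_at_imp_continuous_on ballI has_derivative_continuous[OF has_derivative_rad])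
  then show "connected J"
    by (rule connected_continuous_image) (rule convex_connected[OF convex_UNIV])
  show zero: "0 \<in> J"
    using rangeI[of "rad \<epsilon>" "axis undefined 0"] by (simp add: rad_axis)
  have one: "\<epsilon> undefined \<in> J"
    using rangeI[of "rad \<epsilon>" "axis undefined 1"] by (simp add: rad_axis)
  show "J \<noteq> {y}" for y
  proof
    assume "J = {y}"
    with zero one have "\<epsilon> undefined = 0" by (simp only: singleton_iff)
    then show False using eps[of undefined] by simp
  qed
qed

text \<open>Both \<open>F 0\<close> and 0 are limits of \<open>F\<close> at 0 within
  \<open>J\<close>; they agree because 0 is not isolated in \<open>J\<close>.\<close>

lemma vanishing_extends_to_zero:
  assumes "continuous_on J F" "0 \<in> J" "\<And>r. r \<in> J \<Longrightarrow> r \<noteq> 0 \<Longrightarrow> F r = (0::real)"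
  shows "F 0 = 0"
proof (rule tendsto_unique)
  show "at 0 within J \<noteq> bot"
    using zero_islimpt_J by (simp add: trivial_limit_within)
  show "(F \<longlongrightarrow> F 0) (at 0 within J)"
    using assms(1,2) unfolding continuous_on_def by blast
  have "\<forall>\<^sub>F r in at 0 within J. F r = 0"
    using assms(3) by (simp add: eventually_at_filter)
  then show "(F \<longlongrightarrow> 0) (at 0 within J)"
    by (rule tendsto_eventually)
qed

section \<open>Equivalence with the differential equations\<close>

lemma soliton_iff:
  assumes "CARD('n) \<ge> 2"
  shows "gradient_rho_Einstein_soliton \<rho> \<Lambda> (conformal \<epsilon> \<psi>) (\<lambda>x. h (rad \<epsilon> x)) \<longleftrightarrow>
    (\<forall>r\<in>J. E1 r = 0) \<and> (\<forall>r\<in>J. E2 \<rho> r = \<Lambda>)" (is "?S \<longleftrightarrow> ?E")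
proof
  assume ?S
  have away: "E1 r = 0 \<and> E2 \<rho> r - \<Lambda> = 0" if r: "r \<in> J" "r \<noteq> 0" for r
  proof -
    obtain x where x: "r = rad \<epsilon> x"
      using r(1) by blast
    have "4 * E1 r / \<psi> r = 0 \<and> (E2 \<rho> r - \<Lambda>) / (\<psi> r)\<^sup>2 = 0"
      using \<open>?S\<close> r(2) unfolding soliton_iff_defect x
      by (intro radial_tensor_eq_0[OF assms, of x]) blast+
    then show ?thesis
      using psi_nonzero[OF r(1)] by simp
  qed
  \<comment> \<open>\<open>E1\<close> and \<open>E2\<close> are polynomials in r, \<psi>, h and
    their derivatives up to order two, so continuity of these carries the equations to r =
    0.\<close>
  note cont = smooth_on_interval_continuous[OF psi_smooth]
    smooth_on_interval_continuous[OF h_smooth]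
    smooth_on_interval_continuous[OF smooth_on_interval_deriv_within[OF psi_smooth]]
    smooth_on_interval_continuous[OF smooth_on_interval_deriv_within[OF h_smooth]]
    smooth_on_interval_continuous[OF smooth_on_interval_deriv_within[OF smooth_on_interval_deriv_within[OF psi_smooth]]]
    smooth_on_interval_continuous[OF smooth_on_interval_deriv_within[OF smooth_on_interval_deriv_within[OF h_smooth]]]
  have "continuous_on J E1" "continuous_on J (\<lambda>r. E2 \<rho> r - \<Lambda>)"
    unfolding E1_def [abs_def] E2_def by (intro continuous_intros cont)+
  then have "E1 0 = 0 \<and> E2 \<rho> 0 - \<Lambda> = 0" if "0 \<in> J"
    using vanishing_extends_to_zero[of E1] vanishing_extends_to_zero[of "\<lambda>r. E2 \<rho> r - \<Lambda>"] that away
    by simp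
  with away have "E1 r = 0 \<and> E2 \<rho> r - \<Lambda> = 0" if "r \<in> J" for r
    using that by (cases "r = 0") auto
  then show ?E by simp
next
  assume ?E
  then show ?S
    unfolding soliton_iff_defect by simp
qed

end

theorem corollary1p3:
  fixes \<epsilon> :: "'n::finite \<Rightarrow> real" and \<rho> \<Lambda> n :: real and \<psi> h :: "real \<Rightarrow> real" and J :: "real set"
  assumes dim: "CARD('n) \<ge> 3" and n: "n = real CARD('n)"
    and eps: "\<And>i. \<epsilon> i = 1 \<or> \<epsilon> i = -1"
    and rho: "\<rho> \<noteq> 0"
    and J: "J = range (rad \<epsilon>)"
    and psi_smooth: "smooth_on_interval J \<psi>"
    and h_smooth: "smooth_on_interval J h"
    and psi_nonzero: "\<And>r. r \<in> J \<Longrightarrow> \<psi> r \<noteq> 0"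
  shows "(\<exists>g. semi_riemannian_metric g
            \<and> (\<forall>x. g x = (1 / (\<psi> (rad \<epsilon> x))\<^sup>2) *\<^sub>R pseudo_euclidean \<epsilon> x)
            \<and> gradient_rho_Einstein_soliton \<rho> \<Lambda> g (\<lambda>x. h (rad \<epsilon> x)))
     \<longleftrightarrow>
      (let \<psi>' = deriv_within J \<psi>; \<psi>'' = deriv_within J \<psi>';
           h' = deriv_within J h; h'' = deriv_within J h'
       in (\<forall>r\<in>J. (n - 2) * \<psi>'' r + \<psi> r * h'' r + 2 * \<psi>' r * h' r = 0)
        \<and> (\<forall>r\<in>J. 2 * \<psi> r * ((n - 2) * \<psi>' r + \<psi> r * h' r)
              + 2 * n * (1 - 2 * (n - 1) * \<rho>) * \<psi> r * \<psi>' r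
              + 4 * r * ((n - 1) * ((\<rho> * n - 1) * (\<psi>' r)\<^sup>2 - 2 * \<rho> * \<psi> r * \<psi>'' r)
                         - \<psi> r * \<psi>' r * h' r + \<psi> r * \<psi>'' r)
              = \<Lambda>))"
proof -
  interpret radial_conformal \<epsilon> \<psi> h
    using eps psi_smooth psi_nonzero h_smooth unfolding J by unfold_locales auto
  \<comment> \<open>The prescribed formula determines \<open>g\<close> pointwise, so the existential
    has \<open>conformal \<epsilon> \<psi>\<close> as its only candidate.\<close>
  have "(\<exists>g. semi_riemannian_metric g
            \<and> (\<forall>x. g x = (1 / (\<psi> (rad \<epsilon> x))\<^sup>2) *\<^sub>R pseudo_euclidean \<epsilon> x)
            \<and> gradient_rho_Einstein_soliton \<rho> \<Lambda> g (\<lambda>x. h (rad \<epsilon> x)))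
      \<longleftrightarrow> gradient_rho_Einstein_soliton \<rho> \<Lambda> (conformal \<epsilon> \<psi>) (\<lambda>x. h (rad \<epsilon> x))"
    using semi_riemannian_conformal unfolding conformal_def [symmetric]
    by (auto simp flip: fun_eq_iff)
  also have "\<dots> \<longleftrightarrow> (\<forall>r\<in>range (rad \<epsilon>). E1 r = 0) \<and> (\<forall>r\<in>range (rad \<epsilon>). E2 \<rho> r = \<Lambda>)"
    using dim by (intro soliton_iff) simp
  finally show ?thesis
    unfolding Let_def E1_def E2_def J n .
qed

end
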